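(* Let $k$ be a nonnegative integer and let $Q_k$ be the poset consisting of one minimal element covered by $k$ other elements (so $|Q_k|=k+1$, and the $k$ other elements are pairwise incomparable). Then the Ehrhart polynomial of the order polytope $\mathcal{O}_{Q_k}$ is \[ i(\mathcal{O}_{Q_k},t)=1+\sum_{j=1}^{k}\frac{B_{k-j+1}+(k-j+1)}{k-j+1}\binom{k}{j}t^j+\frac{1}{k+1}t^{k+1}, \] where $B_n$ denotes the $n$th Bernoulli number.
   Context: For a finite poset $(P,\le_P)$, the order polytope $\mathcal{O}_P\subset\mathbb{R}^P$ is the set of functions $f:P\to\mathbb{R}$ with $0\le f(i)\le 1$ for all $i\in P$ and $f(i)\le f(j)$ whenever $i\le_P j$; it is a $(0,1)$-polytope of dimension $|P|$. For an integral polytope $\mathcal{P}$ of dimension $d$, the Ehrhart polynomial $i(\mathcal{P},t)$ is the polynomial (of degree $d$) in $t$ such that $i(\mathcal{P},t)=|t\mathcal{P}\cap\mathbb{Z}^e|$ for all positive integers $t$, where $t\mathcal{P}=\{t\mathbf{x}:\mathbf{x}\in\mathcal{P}\}$. Bernoulli polynomials are defined by $\frac{te^{xt}}{e^t-1}=\sum_{k\ge0}\frac{B_k(x)}{k!}t^k$, and the Bernoulli numbers are $B_k:=B_k(1)$ (so with this convention $B_0=1$, $B_1=1/2$, $B_2=1/6$, $B_4=-1/30$). *)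

theory Defs
  imports
    Complex_Main
    "HOL-Library.FuncSet"
    "HOL-Computational_Algebra.Computational_Algebra"
begin

text \<open>
  A poset is a carrier \<open>P\<close> together with an order relation \<open>r\<close> on it, where \<open>(x, y) \<in> r\<close> means
  \<open>x \<le>\<^sub>P y\<close>. The space \<open>\<real>\<^sup>P\<close> is \<open>P \<rightarrow>\<^sub>E UNIV\<close>: a point is a function on \<open>P\<close>, pinned to
  \<^term>\<open>undefined\<close> outside \<open>P\<close> so that distinct HOL functions are distinct points.
\<close>

definition covered_by :: "'a set \<Rightarrow> ('a \<times> 'a) set \<Rightarrow> 'a \<Rightarrow> 'a \<Rightarrow> bool" where
  "covered_by P r x y \<longleftrightarrow>
     x \<in> P \<and> y \<in> P \<and> x \<noteq> y \<and> (x, y) \<in> r \<and>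
     \<not> (\<exists>z\<in>P. z \<noteq> x \<and> z \<noteq> y \<and> (x, z) \<in> r \<and> (z, y) \<in> r)"

definition is_Q :: "nat \<Rightarrow> 'a set \<Rightarrow> ('a \<times> 'a) set \<Rightarrow> bool" where
  "is_Q k P r \<longleftrightarrow>
     finite P \<and> partial_order_on P r \<and>
     (\<exists>m\<in>P. (\<forall>x\<in>P. (x, m) \<in> r \<longrightarrow> x = m) \<and>
            card (P - {m}) = k \<and>
            (\<forall>x\<in>P - {m}. covered_by P r m x) \<and>
            (\<forall>x\<in>P - {m}. \<forall>y\<in>P - {m}. x \<noteq> y \<longrightarrow> (x, y) \<notin> r \<and> (y, x) \<notin> r))"

lemma is_Q_card: "is_Q k P r \<Longrightarrow> card P = k + 1"
  unfolding is_Q_def by (metis Suc_eq_plus1 card.remove)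

lemma is_Q_example: "is_Q k {0..k} {(i, j). i \<le> k \<and> j \<le> k \<and> (i = j \<or> i = 0)}"
proof -
  let ?r = "{(i, j). i \<le> k \<and> j \<le> k \<and> (i = j \<or> i = 0)}"
  have "partial_order_on {0..k} ?r"
    by (auto simp: partial_order_on_def preorder_on_def refl_on_def trans_def antisym_def)
  moreover have "card ({0..k} - {0}) = k"
    by simp
  moreover have "\<forall>x\<in>{0..k} - {0}. covered_by {0..k} ?r 0 x"
    by (auto simp: covered_by_def)
  ultimately show ?thesis
    unfolding is_Q_def by (intro conjI bexI[of _ 0]) auto
qed

definition order_polytope :: "'a set \<Rightarrow> ('a \<times> 'a) set \<Rightarrow> ('a \<Rightarrow> real) set" where
  "order_polytope P r =
     {f \<in> P \<rightarrow>\<^sub>E UNIV. (\<forall>i\<in>P. 0 \<le> f i \<and> f i \<le> 1) \<and>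
                     (\<forall>i\<in>P. \<forall>j\<in>P. (i, j) \<in> r \<longrightarrow> f i \<le> f j)}"

definition dilate :: "'a set \<Rightarrow> real \<Rightarrow> ('a \<Rightarrow> real) set \<Rightarrow> ('a \<Rightarrow> real) set" where
  "dilate P t S = (\<lambda>f. \<lambda>i\<in>P. t * f i) ` S"

text \<open>
  \<open>is_ehrhart_poly P S p\<close>: \<open>p\<close> is the Ehrhart polynomial of the polytope \<open>S\<close> in \<open>\<real>\<^sup>P\<close>.
  The definite article is justified by \<open>is_ehrhart_poly_unique\<close> below.
\<close>

definition is_ehrhart_poly :: "'a set \<Rightarrow> ('a \<Rightarrow> real) set \<Rightarrow> real poly \<Rightarrow> bool" where
  "is_ehrhart_poly P S p \<longleftrightarrow>
     (\<forall>t::nat. t > 0 \<longrightarrow>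
        finite (dilate P (real t) S \<inter> (P \<rightarrow>\<^sub>E \<int>)) \<and>
        poly p (real t) = real (card (dilate P (real t) S \<inter> (P \<rightarrow>\<^sub>E \<int>))))"

lemma is_ehrhart_poly_unique:
  assumes "is_ehrhart_poly P S p" "is_ehrhart_poly P S q"
  shows "p = q"
proof (rule ccontr)
  assume "p \<noteq> q"
  then have "finite {x. poly (p - q) x = 0}"
    by (intro poly_roots_finite) simp
  moreover have "real ` {0<..} \<subseteq> {x. poly (p - q) x = 0}"
    using assms by (auto simp: is_ehrhart_poly_def)
  ultimately have "finite (real ` {0<..})"
    by (rule rev_finite_subset)
  then show False
    by (simp add: finite_image_iff infinite_Ioi)
qed

text \<open>
  Division of formal power series cancels the common factor \<open>t\<close> of numerator and denominator,
  so the generating function can be written as a quotient; see \<open>bernoulli_gf\<close>.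
\<close>

definition bernoulli_poly :: "nat \<Rightarrow> real \<Rightarrow> real" where
  "bernoulli_poly k x = fact k * fps_nth (fps_X * fps_exp x / (fps_exp 1 - 1)) k"

definition bernoulli :: "nat \<Rightarrow> real" where
  "bernoulli k = bernoulli_poly k 1"

lemma bernoulli_gf:
  "Abs_fps (\<lambda>k. bernoulli_poly k x / fact k) * (fps_exp 1 - 1) = fps_X * fps_exp x"
proof -
  let ?g = "fps_exp 1 - 1 :: real fps"
  have nz: "?g \<noteq> 0"
  proof
    assume "?g = 0"
    then have "fps_nth ?g 1 = 0" by simp
    then show False by simp
  qed
  have "subdegree ?g = 1"
    by (rule subdegreeI) auto
  moreover have "subdegree (fps_X * fps_exp x) = 1"
    by (rule subdegreeI) auto
  ultimately have "?g dvd fps_X * fps_exp x"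
    using nz by (simp add: fps_dvd_iff)
  moreover have "Abs_fps (\<lambda>k. bernoulli_poly k x / fact k) = fps_X * fps_exp x / ?g"
    by (simp add: bernoulli_poly_def fps_eq_iff)
  ultimately show ?thesis by simp
qed

end

theory Submission
  imports Defs
begin

text \<open>
  A lattice point of the polytope dilated by \<open>t\<close> is a value \<open>a \<in> {0..t}\<close> at the minimum together with \<open>k\<close>
  independent values in \<open>{a..t}\<close>, so the count is \<open>(t + 1)\<^sup>k + \<Sum>\<^bsub>n=1..t\<^esub> n\<^sup>k\<close>. Expanding the first
  summand binomially and the second by Faulhaber's formula gives the two parts of each
  coefficient. Faulhaber's formula itself compares coefficients in the product of the Bernoulli
  generating function with \<open>e\<^bsup>Nz\<^esup> - 1\<close>, which is \<open>z\<close> times a geometric sum of exponentials.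
\<close>

text \<open>The sum telescopes. The product form avoids a quotient: \<open>fps_exp 1 - 1\<close> has
  zero constant term, so it is not a unit among power series.\<close>

lemma fps_geometric_sum_exp:
  "(fps_exp 1 - 1) * (\<Sum>n=1..N. fps_exp (real n)) = fps_exp 1 * (fps_exp (real N) - 1)"
proof (induction N)
  case (Suc N)
  have "fps_exp (real (Suc N)) = fps_exp 1 * fps_exp (real N)"
    by (simp flip: fps_exp_add_mult)
  then show ?case
    using Suc by (simp add: algebra_simps)
qed simp

lemma sum_powers_bernoulli:
  "(\<Sum>n=1..N. real n ^ k) =
     (\<Sum>i\<le>k. bernoulli i * real (k + 1 choose i) * real N ^ (k + 1 - i)) / real (k + 1)"
proof -
  let ?B = "Abs_fps (\<lambda>i. bernoulli i / fact i)"
  let ?S = "\<Sum>n=1..N. fps_exp (real n)"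
  let ?D = "fps_exp 1 - 1 :: real fps"
  \<comment> \<open>Both sides carry the factor \<open>?D\<close>, which cancels because power
    series over a field form an integral domain.\<close>
  have "?D * (fps_X * ?S) = ?D * (?B * (fps_exp (real N) - 1))"
  proof -
    have "?D * (fps_X * ?S) = fps_X * fps_exp 1 * (fps_exp (real N) - 1)"
      using fps_geometric_sum_exp[of N] by (metis mult.assoc mult.left_commute)
    also have "fps_X * fps_exp 1 = ?B * ?D"
      using bernoulli_gf[of 1] by (simp add: bernoulli_def)
    finally show ?thesis
      by (simp add: mult_ac)
  qed
  moreover have "fps_nth ?D 1 \<noteq> 0"
    by simp
  then have "?D \<noteq> 0"
    by (metis fps_zero_nth)
  ultimately have "fps_X * ?S = ?B * (fps_exp (real N) - 1)"
    by simp
  then have "fps_nth (fps_X * ?S) (k + 1) = fps_nth (?B * (fps_exp (real N) - 1)) (k + 1)"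
    by (rule arg_cong)
  moreover have "fps_nth (fps_X * ?S) (k + 1) = fps_nth ?S k"
    by (simp only: fps_X_mult_nth) simp
  ultimately have "fps_nth ?S k = fps_nth (?B * (fps_exp (real N) - 1)) (k + 1)"
    by (rule subst[rotated])
  \<comment> \<open>The Cauchy product runs up to \<open>i = k + 1\<close>, but its last term
    vanishes: \<open>fps_exp (real N) - 1\<close> has zero constant term.\<close>
  also have "\<dots> = (\<Sum>i\<le>k. bernoulli i / fact i * (real N ^ (k + 1 - i) / fact (k + 1 - i)))"
    by (auto simp: fps_mult_nth atLeast0AtMost intro!: sum.cong)
  also have "\<dots> = (\<Sum>i\<le>k. bernoulli i * real (k + 1 choose i) * real N ^ (k + 1 - i)) / fact (k + 1)"
    unfolding sum_divide_distrib
    by (intro sum.cong refl) (simp add: binomial_fact del: fact_Suc)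
  finally have "fact k * fps_nth ?S k =
      fact k * ((\<Sum>i\<le>k. bernoulli i * real (k + 1 choose i) * real N ^ (k + 1 - i)) / fact (k + 1))"
    by (rule arg_cong)
  moreover have "fact k * (x / fact (k + 1)) = x / real (k + 1)" for x :: real
    by (simp only: Suc_eq_plus1[symmetric] fact_Suc) simp
  moreover have "fact k * fps_nth ?S k = (\<Sum>n=1..N. real n ^ k)"
    by (simp add: fps_sum_nth sum_distrib_left)
  ultimately show ?thesis
    by (simp only:)
qed

lemma bernoulli_0: "bernoulli 0 = 1"
  using sum_powers_bernoulli[of 0 1] by simp

text \<open>Substituting \<open>i = k - j + 1\<close> in Faulhaber's formula orders it by powers of
  N, ready for comparison with the target polynomial. The index \<open>i = 0\<close> yields the
  leading term.\<close>

lemma sum_powers_bernoulli_ascending: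
  "(\<Sum>n=1..N. real n ^ k) =
     (\<Sum>j=1..k. bernoulli (k - j + 1) / real (k - j + 1) * real (k choose j) * real N ^ j)
       + real N ^ (k + 1) / real (k + 1)"
proof -
  define c where "c i = bernoulli i * real (k + 1 choose i) * real N ^ (k + 1 - i)" for i
  \<comment> \<open>The absorption identity for binomial coefficients moves the denominator from
    \<open>k + 1\<close> to \<open>k - j + 1\<close>.\<close>
  have absorb: "real (k + 1 choose (k - j + 1)) / real (k + 1) = real (k choose j) / real (k - j + 1)"
    if "j \<in> {1..k}" for j
  proof -
    have "Suc (k - j) * (Suc k choose Suc (k - j)) = Suc k * (k choose (k - j))"
      by (rule Suc_times_binomial)
    also have "k choose (k - j) = k choose j"
      using that by (intro binomial_symmetric[symmetric]) simp
    finally have "real (k - j + 1) * real (k + 1 choose (k - j + 1)) = real (k + 1) * real (k choose j)"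
      by (metis Suc_eq_plus1 of_nat_mult)
    then show ?thesis
      by (simp add: frac_eq_eq mult.commute del: of_nat_Suc of_nat_add)
  qed
  have "(\<Sum>i\<le>k. c i) = c 0 + (\<Sum>i=1..k. c i)"
    by (simp add: sum.atLeast_Suc_atMost flip: atLeast0AtMost)
  also have "(\<Sum>i=1..k. c i) = (\<Sum>j=1..k. c (k - j + 1))"
    by (rule sum.reindex_bij_witness[of _ "\<lambda>j. k - j + 1" "\<lambda>j. k - j + 1"]) auto
  finally have "(\<Sum>i\<le>k. c i) / real (k + 1) =
      (\<Sum>j=1..k. c (k - j + 1) / real (k + 1)) + c 0 / real (k + 1)"
    by (simp add: sum_divide_distrib add_divide_distrib)
  also have "(\<Sum>j=1..k. c (k - j + 1) / real (k + 1)) =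
      (\<Sum>j=1..k. bernoulli (k - j + 1) / real (k - j + 1) * real (k choose j) * real N ^ j)"
  proof (intro sum.cong refl)
    fix j assume j: "j \<in> {1..k}"
    have "c (k - j + 1) / real (k + 1) =
        bernoulli (k - j + 1) * (real (k + 1 choose (k - j + 1)) / real (k + 1)) * real N ^ j"
      using j by (simp add: c_def)
    then show "c (k - j + 1) / real (k + 1) =
        bernoulli (k - j + 1) / real (k - j + 1) * real (k choose j) * real N ^ j"
      unfolding absorb[OF j] by simp
  qed
  also have "c 0 = real N ^ (k + 1)"
    by (simp add: c_def bernoulli_0)
  finally show ?thesis
    unfolding sum_powers_bernoulli c_def .
qed

lemma dilate_order_polytope:
  assumes "t > 0"
  shows "dilate P t (order_polytope P r) =
    {g \<in> P \<rightarrow>\<^sub>E UNIV. (\<forall>i\<in>P. 0 \<le> g i \<and> g i \<le> t) \<and> (\<forall>i\<in>P. \<forall>j\<in>P. (i, j) \<in> r \<longrightarrow> g i \<le> g j)}"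
    (is "?L = ?R")
proof (intro equalityI subsetI)
  fix g assume "g \<in> ?L"
  then show "g \<in> ?R"
    using assms by (auto simp: dilate_def order_polytope_def mult_left_le)
next
  fix g assume g: "g \<in> ?R"
  \<comment> \<open>The preimage under scaling; restricting it to \<open>P\<close> keeps it
    \<open>undefined\<close> elsewhere, as membership in the polytope demands.\<close>
  let ?f = "\<lambda>i\<in>P. g i / t"
  have "?f \<in> order_polytope P r"
    using g assms by (auto simp: order_polytope_def divide_right_mono)
  moreover have "g = (\<lambda>i\<in>P. t * ?f i)"
    using g assms by (auto simp: fun_eq_iff PiE_def extensional_def restrict_def)
  ultimately show "g \<in> ?L"
    unfolding dilate_def by blast
qed

text \<open>Once the value \<open>a\<close> at \<open>m\<close> is fixed, monotonicity only bounds
  the other values below by \<open>a\<close>, so each fibre is a product of finite sets.\<close>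

lemma lattice_points_Q:
  fixes P :: "'a set" and t :: nat
  assumes "t > 0" "m \<in> P"
    and r: "\<And>i j. i \<in> P \<Longrightarrow> j \<in> P \<Longrightarrow> (i, j) \<in> r \<longleftrightarrow> i = j \<or> i = m"
  shows "dilate P (real t) (order_polytope P r) \<inter> (P \<rightarrow>\<^sub>E \<int>) =
    (\<Union>a\<in>{..t}. PiE P (\<lambda>i. if i = m then {real a} else real ` {a..t}))"
    (is "?L = (\<Union>a\<in>_. PiE P (?F a))")
proof (intro equalityI subsetI)
  fix g assume "g \<in> ?L"
  then have g: "g \<in> P \<rightarrow>\<^sub>E \<int>" "\<And>i. i \<in> P \<Longrightarrow> 0 \<le> g i \<and> g i \<le> real t" "\<And>i. i \<in> P \<Longrightarrow> g m \<le> g i"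
    using assms by (auto simp: dilate_order_polytope)
  have nat: "\<exists>n\<le>t. g i = real n" if "i \<in> P" for i
  proof -
    have "g i \<in> \<int>" "g i \<ge> 0"
      using g that by auto
    then have "g i \<in> \<nat>"
      by (simp add: Nats_altdef2)
    then show ?thesis
      using g(2)[OF that] by (auto elim!: Nats_cases)
  qed
  obtain a where a: "a \<le> t" "g m = real a"
    using nat \<open>m \<in> P\<close> by blast
  have "g \<in> PiE P (?F a)"
  proof (rule PiE_I)
    fix i assume i: "i \<in> P"
    obtain n where "n \<le> t" "g i = real n"
      using nat i by blast
    then show "g i \<in> ?F a i"
      using a g(3)[OF i] by auto
  next
    fix i assume "i \<notin> P"
    then show "g i = undefined"
      using g(1) by (rule PiE_arb[rotated])
  qed
  then show "g \<in> (\<Union>a\<in>{..t}. PiE P (?F a))"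
    using a(1) by blast
next
  fix g assume "g \<in> (\<Union>a\<in>{..t}. PiE P (?F a))"
  then obtain a where a: "a \<le> t" and g: "g \<in> PiE P (?F a)"
    by blast
  have m: "g m = real a"
    using PiE_mem[OF g \<open>m \<in> P\<close>] by simp
  have "g i \<in> \<int> \<and> real a \<le> g i \<and> g i \<le> real t" if "i \<in> P" for i
    using PiE_mem[OF g that] a by (auto split: if_splits)
  moreover have "real a \<ge> 0"
    by simp
  ultimately show "g \<in> ?L"
    using g m assms by (fastforce simp: dilate_order_polytope PiE_def Pi_def)
qed

text \<open>Minimality excludes relations into \<open>m\<close> from other elements, covering puts
  \<open>m\<close> below every element, and incomparability excludes all remaining pairs.\<close>

lemma is_Q_order:
  assumes "is_Q k P r"
  obtains m where "m \<in> P" "finite P" "card (P - {m}) = k"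
    "\<And>i j. i \<in> P \<Longrightarrow> j \<in> P \<Longrightarrow> (i, j) \<in> r \<longleftrightarrow> i = j \<or> i = m"
proof -
  obtain m where m: "m \<in> P" "\<forall>x\<in>P. (x, m) \<in> r \<longrightarrow> x = m" "card (P - {m}) = k"
      "\<forall>x\<in>P - {m}. covered_by P r m x"
      "\<forall>x\<in>P - {m}. \<forall>y\<in>P - {m}. x \<noteq> y \<longrightarrow> (x, y) \<notin> r \<and> (y, x) \<notin> r"
    using assms unfolding is_Q_def by blast
  have "finite P" and refl: "\<And>x. x \<in> P \<Longrightarrow> (x, x) \<in> r"
    using assms by (auto simp: is_Q_def partial_order_on_def preorder_on_def refl_on_def)
  moreover have "(i, j) \<in> r \<longleftrightarrow> i = j \<or> i = m" if "i \<in> P" "j \<in> P" for i j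
    using m that refl unfolding covered_by_def by blast
  ultimately show ?thesis
    using that m by blast
qed

text \<open>The fibre over \<open>a\<close> leaves \<open>t + 1 - a\<close> choices at each of the
  \<open>k\<close> upper elements; as \<open>a\<close> runs from 0 to \<open>t\<close>, this number
  runs from \<open>t + 1\<close> down to 1.\<close>

lemma card_lattice_points_Q:
  assumes "is_Q k P r" "t > 0"
  shows "finite (dilate P (real t) (order_polytope P r) \<inter> (P \<rightarrow>\<^sub>E \<int>))"
    and "card (dilate P (real t) (order_polytope P r) \<inter> (P \<rightarrow>\<^sub>E \<int>)) = (\<Sum>n=1..t+1. n ^ k)"
proof -
  obtain m where m: "m \<in> P" "finite P" "card (P - {m}) = k"
    "\<And>i j. i \<in> P \<Longrightarrow> j \<in> P \<Longrightarrow> (i, j) \<in> r \<longleftrightarrow> i = j \<or> i = m"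
    using is_Q_order[OF assms(1)] by blast
  let ?F = "\<lambda>a i. if i = m then {real a} else real ` {a..t}"
  have eq: "dilate P (real t) (order_polytope P r) \<inter> (P \<rightarrow>\<^sub>E \<int>) = (\<Union>a\<in>{..t}. PiE P (?F a))"
    using lattice_points_Q[OF assms(2) m(1,4)] by blast
  have fin: "finite (PiE P (?F a))" for a
    using m(2) by (intro finite_PiE) auto
  then show "finite (dilate P (real t) (order_polytope P r) \<inter> (P \<rightarrow>\<^sub>E \<int>))"
    unfolding eq by blast
  have card_fiber: "card (PiE P (?F a)) = (t + 1 - a) ^ k" for a
  proof -
    have "card (PiE P (?F a)) = card (?F a m) * (\<Prod>i\<in>P - {m}. card (?F a i))"
      using m by (simp only: card_PiE prod.remove[OF m(2,1)])
    also have "(\<Prod>i\<in>P - {m}. card (?F a i)) = (\<Prod>i\<in>P - {m}. t + 1 - a)"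
      by (intro prod.cong) (auto simp: card_image)
    finally show ?thesis
      by (simp add: m(3))
  qed
  \<comment> \<open>The value at \<open>m\<close> determines the fibre.\<close>
  have "PiE P (?F a) \<inter> PiE P (?F b) = {}" if "a \<noteq> b" for a b
    using m(1) that by (auto dest!: PiE_mem[of _ _ _ m])
  then have "card (\<Union>a\<in>{..t}. PiE P (?F a)) = (\<Sum>a\<le>t. card (PiE P (?F a)))"
    using fin by (intro card_UN_disjoint) auto
  also have "\<dots> = (\<Sum>a\<le>t. (t + 1 - a) ^ k)"
    by (simp only: card_fiber)
  also have "\<dots> = (\<Sum>n=1..t+1. n ^ k)"
    by (rule sum.reindex_bij_witness[of _ "\<lambda>n. t + 1 - n" "\<lambda>a. t + 1 - a"]) auto
  finally show "card (dilate P (real t) (order_polytope P r) \<inter> (P \<rightarrow>\<^sub>E \<int>)) = (\<Sum>n=1..t+1. n ^ k)"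
    unfolding eq .
qed

theorem theorem1p4:
  fixes k :: nat and P :: "'a set" and r :: "('a \<times> 'a) set"
  assumes "is_Q k P r"
  shows "is_ehrhart_poly P (order_polytope P r)
           (1 + (\<Sum>j=1..k. monom ((bernoulli (k - j + 1) + real (k - j + 1)) / real (k - j + 1)
                                   * real (k choose j)) j)
              + monom (1 / real (k + 1)) (k + 1))"
    (is "is_ehrhart_poly _ _ ?p")
  unfolding is_ehrhart_poly_def
proof (intro allI impI conjI)
  fix t :: nat assume t: "t > 0"
  show "finite (dilate P (real t) (order_polytope P r) \<inter> (P \<rightarrow>\<^sub>E \<int>))"
    using card_lattice_points_Q(1)[OF assms t] .
  have binomial: "real (t + 1) ^ k = 1 + (\<Sum>j=1..k. real (k choose j) * real t ^ j)"
    using binomial_ring[of "real t" 1 k]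
    by (simp add: sum.atLeast_Suc_atMost add.commute flip: atLeast0AtMost)
  have "poly ?p (real t) =
      1 + (\<Sum>j=1..k. (bernoulli (k - j + 1) / real (k - j + 1) + 1) * real (k choose j) * real t ^ j)
        + real t ^ (k + 1) / real (k + 1)"
    by (simp add: poly_sum poly_monom add_divide_distrib del: of_nat_Suc)
  \<comment> \<open>In each coefficient the Bernoulli quotient comes from the power sum and the
    summand 1 from the binomial expansion; that expansion also supplies the constant term.\<close>
  also have "\<dots> = (\<Sum>n=1..t. real n ^ k) + real (t + 1) ^ k"
    unfolding sum_powers_bernoulli_ascending binomial
    by (simp add: distrib_right sum.distrib)
  also have "\<dots> = real (\<Sum>n=1..t+1. n ^ k)"
    by simp
  finally show "poly ?p (real t) = real (card (dilate P (real t) (order_polytope P r) \<inter> (P \<rightarrow>\<^sub>E \<int>)))"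
    unfolding card_lattice_points_Q(2)[OF assms t] .
qed

end
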